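(* If a permutation $w \in S_n$ has an L-shaped soliton decomposition, that is, the shape of $\mathrm{SD}(w)$ is of the form $(s,1,1,\dots,1)$, then the steady-state time of $w$ is either $0$ or $1$.
   Context: Box-ball system (BBS). Boxes are indexed by $\mathbb{Z}$ from left to right. A BBS configuration (with $n$ balls) is a sequence $X$ indexed by $\mathbb{Z}$ in which each of $1,\dots,n$ (the balls) appears exactly once and every other entry is $e := n+1$ (an empty box). One BBS move transforms $X$ into $\mathrm{BB}(X)$: the balls $1,2,\dots,n$, in this order, each jump once, to the nearest box to the right of the ball that is empty at that moment (the box a ball leaves becomes empty). $\mathrm{BB}^t(X)$ is the result of $t$ BBS moves. A permutation $w = w_1\cdots w_n \in S_n$ (one-line notation) is regarded as the configuration with ball $w_i$ in box $i$ for $1\le i\le n$ and all other boxes empty. An increasing run of a configuration is a maximal contiguous (occupying consecutive boxes) increasing nonempty sequence of balls. A soliton is an increasing run that is preserved by all subsequent BBS moves (it remains an increasing run in all later configurations). A configuration is in steady state if every ball is contained in a soliton. Every box-ball system reaches steady state after finitely many moves, and then the sizes of the solitons weakly increase from left to right. The steady-state time of $w$ is the least $t\ge 0$ such that $\mathrm{BB}^t(w)$ is in steady state. The soliton decomposition $\mathrm{SD}(w)$ is the tableau whose first (top) row is the rightmost soliton of a steady-state configuration $\mathrm{BB}^t(w)$, whose second row is the second rightmost soliton, and so on. Its shape is the partition of row lengths. In the L-shape $(s,1,\dots,1)$ the number of parts equal to $1$ following $s$ may be zero. *)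

theory Defs
  imports Complex_Main "HOL-Combinatorics.Permutations"
begin

text \<open>
  A configuration with \<open>n\<close> balls is a function \<open>X :: int \<Rightarrow> nat\<close> taking each of the values
  \<open>1, \<dots>, n\<close> exactly once and the value \<open>n + 1\<close> (an empty box) everywhere else.
\<close>

definition empty_box :: "nat \<Rightarrow> nat" where
  "empty_box n = n + 1"

definition perm_config :: "nat \<Rightarrow> (nat \<Rightarrow> nat) \<Rightarrow> int \<Rightarrow> nat" where
  "perm_config n w = (\<lambda>i. if 1 \<le> i \<and> i \<le> int n then w (nat i) else empty_box n)"

definition ball_pos :: "(int \<Rightarrow> nat) \<Rightarrow> nat \<Rightarrow> int" where
  "ball_pos X b = (THE i. X i = b)"

text \<open>The minimum of integers below exists because every ball has an empty box to its right.\<close>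

definition ball_jump :: "nat \<Rightarrow> nat \<Rightarrow> (int \<Rightarrow> nat) \<Rightarrow> int \<Rightarrow> nat" where
  "ball_jump n b X =
     (let i = ball_pos X b;
          j = (LEAST j. i < j \<and> X j = empty_box n)
      in X(i := empty_box n, j := b))"

definition bbs_move :: "nat \<Rightarrow> (int \<Rightarrow> nat) \<Rightarrow> int \<Rightarrow> nat" where
  "bbs_move n X = fold (ball_jump n) [1..<Suc n] X"

definition increasing_block :: "nat \<Rightarrow> (int \<Rightarrow> nat) \<Rightarrow> int \<Rightarrow> int \<Rightarrow> bool" where
  "increasing_block n X a b \<longleftrightarrow>
     a \<le> b \<and> (\<forall>i\<in>{a..b}. X i \<in> {1..n}) \<and> strict_mono_on {a..b} X"

text \<open>
  A run is identified with its word of balls, without its position, so that it makes sense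
  for the same run to occur in different configurations.
\<close>

definition increasing_run :: "nat \<Rightarrow> (int \<Rightarrow> nat) \<Rightarrow> nat list \<Rightarrow> bool" where
  "increasing_run n X r \<longleftrightarrow>
     (\<exists>a b. increasing_block n X a b \<and>
        (\<forall>a' b'. increasing_block n X a' b' \<and> a' \<le> a \<and> b \<le> b' \<longrightarrow> a' = a \<and> b' = b) \<and>
        r = map X [a..b])"

definition soliton :: "nat \<Rightarrow> (int \<Rightarrow> nat) \<Rightarrow> nat list \<Rightarrow> bool" where
  "soliton n X r \<longleftrightarrow> (\<forall>t. increasing_run n ((bbs_move n ^^ t) X) r)"

definition steady_state :: "nat \<Rightarrow> (int \<Rightarrow> nat) \<Rightarrow> bool" where
  "steady_state n X \<longleftrightarrow> (\<forall>b\<in>{1..n}. \<exists>r. soliton n X r \<and> b \<in> set r)"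

definition steady_state_time :: "nat \<Rightarrow> (nat \<Rightarrow> nat) \<Rightarrow> nat" where
  "steady_state_time n w = (LEAST t. steady_state n ((bbs_move n ^^ t) (perm_config n w)))"

text \<open>\<open>T\<close> lists all solitons of \<open>X\<close> from the rightmost to the leftmost one.\<close>

definition soliton_rows :: "nat \<Rightarrow> (int \<Rightarrow> nat) \<Rightarrow> nat list list \<Rightarrow> bool" where
  "soliton_rows n X T \<longleftrightarrow>
     set T = {r. soliton n X r} \<and>
     sorted_wrt (\<lambda>r s. ball_pos X (hd s) < ball_pos X (hd r)) T"

text \<open>
  The soliton decomposition does not depend on which steady-state configuration is used.  It is
  introduced as a relation, with any such configuration allowed, so that no
  particular choice of \<open>t\<close> enters the definition.
\<close>

definition is_soliton_decomposition :: "nat \<Rightarrow> (nat \<Rightarrow> nat) \<Rightarrow> nat list list \<Rightarrow> bool" where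
  "is_soliton_decomposition n w T \<longleftrightarrow>
     (\<exists>t. steady_state n ((bbs_move n ^^ t) (perm_config n w)) \<and>
          soliton_rows n ((bbs_move n ^^ t) (perm_config n w)) T)"

definition tableau_shape :: "nat list list \<Rightarrow> nat list" where
  "tableau_shape T = map length T"

definition L_shape :: "nat list \<Rightarrow> bool" where
  "L_shape p \<longleftrightarrow> (\<exists>s k. s \<ge> 1 \<and> p = s # replicate k 1)"

end

theory Submission
  imports Defs
begin

text \<open>
  Watch one move \<open>X \<mapsto> Y\<close> from between the boxes \<open>j\<close> and \<open>j + 1\<close>: the balls that jump across this gap
  form the \<^emph>\<open>carrier\<close> \<open>C j\<close>.  A carrier travelling from left to right performs row insertion: it
  picks up the ball in box \<open>j\<close> and drops there the smallest of its balls that is larger than the one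
  picked up, or its smallest ball if the box was empty.  This local rule gives two invariants.

  \<^item> The number of increasing runs.  By the bumping argument of row insertion, \<open>Y (j + 1) < Y j\<close>
    holds exactly if a run of \<open>X\<close> ends in box \<open>j\<close>; so the runs of \<open>Y\<close> start one box to the right of the
    ends of the runs of \<open>X\<close> (\<open>run_starts_after\<close>).

  \<^item> The maximal size of a carrier.  It equals the maximum, over all windows of boxes, of the length
    of an increasing subsequence minus the number of empty boxes in the window.  This quantity for
    \<open>X\<close> bounds the carriers from above (\<open>carrier_increasing_excess\<close>).  The move is
    reversible by a carrier travelling from right to left with the same contents, hence the same
    quantity for \<open>Y\<close> bounds the largest carrier from below
    (\<open>increasing_excess_carrier\<close>).  Together, the quantity never grows.

  Now let \<open>w\<close> be a permutation whose decomposition has shape \<open>(s, 1, \<dots>, 1)\<close> with \<open>k\<close> ones, so that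
  \<open>n = s + k\<close>.  Since \<open>w\<close> has no gaps, its carrier never shrinks before box \<open>n\<close> and is then emptied in
  increasing order: after one move, the balls to the right of box \<open>n\<close> form a single run, whose size is
  that of the largest carrier.  The second invariant makes it at least \<open>s\<close>.  So at most \<open>k\<close> balls lie
  to its left, but by the first invariant they form \<open>k\<close> runs; each of these runs is a single ball
  (\<open>packed_singles_then_run\<close>).

  Finally, single balls followed by one run are in steady state: every move shifts each single ball
  by one box and the last run by its length, so it creates no new ascent between neighbouring balls
  (\<open>singles_then_run_after\<close>).
\<close>

section \<open>Configurations\<close>

definition configuration :: "nat \<Rightarrow> (int \<Rightarrow> nat) \<Rightarrow> bool" where
  "configuration n X \<longleftrightarrow> (\<forall>i. X i \<in> {1..n + 1}) \<and> (\<forall>b\<in>{1..n}. \<exists>!i. X i = b)"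

lemma configuration_range:
  assumes "configuration n X"
  shows "1 \<le> X i" "X i \<le> n + 1"
  using assms unfolding configuration_def by (auto simp: Suc_le_eq)

lemma ball_pos_eq_iff:
  assumes "configuration n X" and "b \<in> {1..n}"
  shows "X i = b \<longleftrightarrow> i = ball_pos X b"
proof -
  have ex: "\<exists>!i. X i = b"
    using assms unfolding configuration_def by blast
  have "X (ball_pos X b) = b"
    unfolding ball_pos_def by (rule theI'[OF ex])
  with ex show ?thesis by auto
qed

lemma ball_pos_of_ball:
  assumes "configuration n X" and "X i \<le> n"
  shows "ball_pos X (X i) = i"
  using ball_pos_eq_iff[OF assms(1), of "X i" i] configuration_range[OF assms(1), of i] assms(2)
  by auto

lemma ball_at_ball_pos:
  assumes "configuration n X" and "b \<in> {1..n}"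
  shows "X (ball_pos X b) = b"
  using ball_pos_eq_iff[OF assms] by blast

lemma balls_positions:
  assumes "configuration n X"
  shows "{i. X i \<le> n} = ball_pos X ` {1..n}"
proof (intro equalityI subsetI)
  fix i assume "i \<in> {i. X i \<le> n}"
  then have "X i \<in> {1..n}" "i = ball_pos X (X i)"
    using configuration_range[OF assms, of i] ball_pos_of_ball[OF assms, of i] by auto
  then show "i \<in> ball_pos X ` {1..n}" by blast
qed (use ball_at_ball_pos[OF assms] in auto)

lemma inj_on_balls:
  assumes "configuration n X"
  shows "inj_on X {i. X i \<le> n}"
  by (rule inj_onI) (metis assms ball_pos_of_ball mem_Collect_eq)

lemma image_balls:
  assumes "configuration n X"
  shows "X ` {i. X i \<le> n} = {1..n}"
  using ball_at_ball_pos[OF assms] by (simp add: balls_positions[OF assms] image_image)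

lemma finite_balls:
  assumes "configuration n X"
  shows "finite {i. X i \<le> n}"
  by (simp add: balls_positions[OF assms])

lemma card_balls:
  assumes "configuration n X"
  shows "card {i. X i \<le> n} = n"
  using card_image[OF inj_on_balls[OF assms]] image_balls[OF assms] by simp

lemma balls_bounded:
  assumes "configuration n X"
  obtains L R where "\<And>i. X i \<le> n \<Longrightarrow> L < i \<and> i < R"
proof -
  have f: "finite {i. X i \<le> n}" by (rule finite_balls[OF assms])
  show ?thesis
  proof (rule that[of "Min (insert 0 {i. X i \<le> n}) - 1" "Max (insert 0 {i. X i \<le> n}) + 1"])
    fix i assume "X i \<le> n"
    then have "Min (insert 0 {i. X i \<le> n}) \<le> i" "i \<le> Max (insert 0 {i. X i \<le> n})"
      using f by auto
    then show "Min (insert 0 {i. X i \<le> n}) - 1 < i \<and> i < Max (insert 0 {i. X i \<le> n}) + 1"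
      by auto
  qed
qed

lemma configuration_perm_config:
  assumes "w permutes {1..n}"
  shows "configuration n (perm_config n w)"
proof -
  have rng: "w i \<in> {1..n}" if "i \<in> {1..n}" for i
    using permutes_in_image[OF assms] that by blast
  have "\<exists>!i. perm_config n w i = b" if b: "b \<in> {1..n}" for b
  proof (rule ex1I)
    have "inv w b \<in> {1..n}"
      using permutes_in_image[OF permutes_inv[OF assms]] b by blast
    then show "perm_config n w (int (inv w b)) = b"
      using permutes_inverses(1)[OF assms] by (auto simp: perm_config_def)
  next
    fix i assume "perm_config n w i = b"
    with b have "1 \<le> i" "w (nat i) = b"
      by (auto simp: perm_config_def empty_box_def split: if_splits)
    then show "i = int (inv w b)"
      using permutes_inverses(2)[OF assms] by force
  qed
  moreover have "perm_config n w i \<in> {1..n + 1}" for i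
  proof (cases "1 \<le> i \<and> i \<le> int n")
    case True
    then have "nat i \<in> {1..n}" by (simp add: nat_le_iff le_nat_iff)
    from rng[OF this] show ?thesis using True by (simp add: perm_config_def)
  qed (auto simp: perm_config_def empty_box_def)
  ultimately show ?thesis by (simp add: configuration_def)
qed

section \<open>One move seen from the positions before and after it\<close>

text \<open>
  Each ball jumps once, so a move is described by the configurations before and after it.  When
  ball \<open>c\<close> jumps, the smaller balls have reached their final boxes and the others are still in their old
  ones.  Hence box \<open>j\<close> is free for \<open>c\<close> iff \<open>Y j\<close> is not a ball smaller than \<open>c\<close> and \<open>X j\<close> is not a ball
  that is at least \<open>c\<close>; the last two assumptions say that \<open>c\<close> stops at a free box and passes
  only over occupied ones.
\<close>

locale bbs_step =
  fixes n :: nat and X Y :: "int \<Rightarrow> nat"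
  assumes before: "configuration n X" and after: "configuration n Y"
    and moves_right: "c \<in> {1..n} \<Longrightarrow> ball_pos X c < ball_pos Y c"
    and lands_on_free: "c \<in> {1..n} \<Longrightarrow> X (ball_pos Y c) < c \<or> X (ball_pos Y c) = n + 1"
    and skips_occupied: "\<lbrakk>c \<in> {1..n}; ball_pos X c < j; j < ball_pos Y c\<rbrakk>
          \<Longrightarrow> Y j < c \<or> c < X j \<and> X j \<le> n"

lemma Least_int_exists:
  fixes i :: int
  assumes "i < k" and "P k"
  defines "j \<equiv> LEAST j. i < j \<and> P j"
  shows "i < j" and "P j" and "\<And>l. \<lbrakk>i < l; P l\<rbrakk> \<Longrightarrow> j \<le> l"
proof -
  define m where "m = (LEAST m::nat. P (i + 1 + int m))"
  have "P (i + 1 + int (nat (k - i - 1)))" using assms(1,2) by simp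
  then have m: "P (i + 1 + int m)"
    unfolding m_def by (rule LeastI)
  have least: "i + 1 + int m \<le> l" if "i < l" "P l" for l
  proof -
    have "P (i + 1 + int (nat (l - i - 1)))" using that by simp
    then have "m \<le> nat (l - i - 1)" unfolding m_def by (rule Least_le)
    then show ?thesis using that by linarith
  qed
  have j: "j = i + 1 + int m"
    unfolding j_def using m least by (intro Least_equality) auto
  show "i < j" "P j" "\<And>l. \<lbrakk>i < l; P l\<rbrakk> \<Longrightarrow> j \<le> l"
    using m least by (auto simp: j)
qed

lemma ball_jump_position:
  assumes "configuration n X" and "b \<in> {1..n}"
  obtains j where "ball_jump n b X = X(ball_pos X b := n + 1, j := b)"
    and "ball_pos X b < j" and "X j = n + 1"
    and "\<And>l. \<lbrakk>ball_pos X b < l; l < j\<rbrakk> \<Longrightarrow> X l \<le> n"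
proof -
  define i where "i = ball_pos X b"
  define j where "j = (LEAST j. i < j \<and> X j = empty_box n)"
  obtain L R where "\<And>i. X i \<le> n \<Longrightarrow> L < i \<and> i < R"
    using balls_bounded[OF assms(1)] by metis
  then have "\<not> X (max R (i + 1)) \<le> n" by fastforce
  then have "i < max R (i + 1)" "X (max R (i + 1)) = empty_box n"
    using configuration_range[OF assms(1), of "max R (i + 1)"] by (auto simp: empty_box_def)
  note least = Least_int_exists[of i "max R (i + 1)" "\<lambda>j. X j = empty_box n", OF this,
      folded j_def]
  show ?thesis
  proof (rule that[of j])
    show "ball_jump n b X = X(ball_pos X b := n + 1, j := b)"
      by (simp add: ball_jump_def Let_def i_def j_def empty_box_def)
    show "ball_pos X b < j" "X j = n + 1"
      using least by (auto simp: i_def empty_box_def)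
    fix l assume "ball_pos X b < l" "l < j"
    then have "X l \<noteq> n + 1" using least(3)[of l] by (auto simp: i_def empty_box_def)
    then show "X l \<le> n" using configuration_range[OF assms(1), of l] by simp
  qed
qed

lemma move_ball:
  assumes X: "configuration n X" and b: "b \<in> {1..n}" and j: "X j = n + 1"
  defines "Y \<equiv> X(ball_pos X b := n + 1, j := b)"
  shows "configuration n Y" and "ball_pos Y b = j"
    and "\<And>c. \<lbrakk>c \<in> {1..n}; c \<noteq> b\<rbrakk> \<Longrightarrow> ball_pos Y c = ball_pos X c"
proof -
  have iff_b: "Y l = b \<longleftrightarrow> l = j" for l
    using ball_pos_eq_iff[OF X b] b by (auto simp: Y_def)
  have iff_c: "Y l = c \<longleftrightarrow> l = ball_pos X c" if "c \<in> {1..n}" "c \<noteq> b" for c l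
    using ball_pos_eq_iff[OF X that(1), of l] ball_pos_eq_iff[OF X b, of l] that j
    by (auto simp: Y_def)
  have "\<exists>!l. Y l = c" if "c \<in> {1..n}" for c
    using iff_b iff_c[OF that] by (cases "c = b") auto
  moreover have "Y l \<in> {1..n + 1}" for l
    using configuration_range[OF X, of l] b by (auto simp: Y_def)
  ultimately show Y: "configuration n Y" by (simp add: configuration_def)
  show "ball_pos Y b = j"
    using iff_b ball_at_ball_pos[OF Y b] by blast
  show "ball_pos Y c = ball_pos X c" if "c \<in> {1..n}" "c \<noteq> b" for c
    using iff_c[OF that] ball_at_ball_pos[OF Y that(1)] by blast
qed

text \<open>
  The configuration after the jumps of the balls \<open>1, \<dots>, m\<close> satisfies the description of \<open>bbs_step\<close>
  for these balls, because the boxes that they have reached do not change any more.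
\<close>

lemma partial_move:
  assumes X: "configuration n X" and "m \<le> n"
  defines "Y \<equiv> fold (ball_jump n) [1..<Suc m] X"
  shows "configuration n Y \<and>
    (\<forall>c\<in>{m<..n}. ball_pos Y c = ball_pos X c) \<and>
    (\<forall>c\<in>{1..m}. ball_pos X c < ball_pos Y c \<and>
       (X (ball_pos Y c) < c \<or> X (ball_pos Y c) = n + 1) \<and>
       (\<forall>j. ball_pos X c < j \<and> j < ball_pos Y c \<longrightarrow> Y j < c \<or> c < X j \<and> X j \<le> n))"
  using assms(2) unfolding Y_def
proof (induction m)
  case 0
  then show ?case using X by simp
next
  case (Suc m)
  define S where "S = fold (ball_jump n) [1..<Suc m] X"
  define b where "b = Suc m"
  have b: "b \<in> {1..n}" using Suc.prems by (simp add: b_def)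
  have S: "configuration n S"
    and waiting: "\<And>c. c \<in> {m<..n} \<Longrightarrow> ball_pos S c = ball_pos X c"
    and moved: "\<And>c. c \<in> {1..m} \<Longrightarrow> ball_pos X c < ball_pos S c \<and>
       (X (ball_pos S c) < c \<or> X (ball_pos S c) = n + 1) \<and>
       (\<forall>j. ball_pos X c < j \<and> j < ball_pos S c \<longrightarrow> S j < c \<or> c < X j \<and> X j \<le> n)"
    using Suc.IH Suc.prems unfolding S_def by auto
  obtain k where jump: "ball_jump n b S = S(ball_pos S b := n + 1, k := b)"
    and right: "ball_pos S b < k" and free: "S k = n + 1"
    and between: "\<And>l. \<lbrakk>ball_pos S b < l; l < k\<rbrakk> \<Longrightarrow> S l \<le> n"
    using ball_jump_position[OF S b] by metis
  define Z where "Z = S(ball_pos S b := n + 1, k := b)"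
  have Z_eq: "fold (ball_jump n) [1..<Suc (Suc m)] X = Z"
    using jump unfolding Z_def S_def b_def by simp
  note Z = move_ball[OF S b free, folded Z_def]
  have pos_b: "ball_pos S b = ball_pos X b"
    using waiting b by (simp add: b_def)
  have unmoved: "X l = S l" if "S l \<in> {m<..n}" for l
  proof -
    have "l = ball_pos S (S l)" using ball_pos_of_ball[OF S, of l] that by simp
    then have "l = ball_pos X (S l)" using waiting that by simp
    then show ?thesis using ball_at_ball_pos[OF X, of "S l"] that by simp
  qed
  have unmoved': "S l = X l" if "X l \<in> {m<..n}" for l
  proof -
    have "l = ball_pos X (X l)" using ball_pos_of_ball[OF X, of l] that by simp
    then have "l = ball_pos S (X l)" using waiting that by simp
    then show ?thesis using ball_at_ball_pos[OF S, of "X l"] that by simp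
  qed
  have keep: "Z l = S l" if "S l \<noteq> n + 1" "S l \<noteq> b" for l
    using that free ball_at_ball_pos[OF S b] by (auto simp: Z_def)
  have "ball_pos Z c = ball_pos X c" if "c \<in> {Suc m<..n}" for c
    using Z(3)[of c] waiting[of c] that by (auto simp: b_def)
  moreover
  have "ball_pos X c < ball_pos Z c \<and>
       (X (ball_pos Z c) < c \<or> X (ball_pos Z c) = n + 1) \<and>
       (\<forall>j. ball_pos X c < j \<and> j < ball_pos Z c \<longrightarrow> Z j < c \<or> c < X j \<and> X j \<le> n)"
    if c: "c \<in> {1..Suc m}" for c
  proof (cases "c = b")
    case True
    have "X k < b \<or> X k = n + 1"
      using unmoved'[of k] free configuration_range[OF X, of k] by (force simp: b_def)
    moreover have "Z j < b \<or> b < X j \<and> X j \<le> n" if j: "ball_pos X b < j" "j < k" for j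
    proof -
      have "S j \<le> n" using between j by (simp add: pos_b)
      moreover have "S j \<noteq> b" using j pos_b ball_pos_of_ball[OF S] \<open>S j \<le> n\<close> by fastforce
      ultimately show ?thesis
        using unmoved[of j] keep[of j] by (cases "S j \<le> m") (auto simp: b_def)
    qed
    ultimately show ?thesis using True Z(2) right pos_b by auto
  next
    case False
    with c have c': "c \<in> {1..m}" by (auto simp: b_def)
    have "ball_pos Z c = ball_pos S c" using Z(3)[of c] c' Suc.prems False by auto
    moreover have "Z j < c" if "S j < c" for j
      using keep[of j] that c' Suc.prems by (auto simp: b_def)
    ultimately show ?thesis using moved[OF c'] by metis
  qed
  ultimately show ?case unfolding Z_eq using Z(1) by blast
qed

lemma bbs_step_bbs_move:
  assumes "configuration n X"
  shows "bbs_step n X (bbs_move n X)"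
  using partial_move[OF assms order_refl] assms unfolding bbs_move_def[symmetric]
  by unfold_locales auto

lemma configuration_bbs_moves:
  assumes "configuration n X"
  shows "configuration n ((bbs_move n ^^ t) X)"
proof (induction t)
  case (Suc t)
  then show ?case using bbs_step.after[OF bbs_step_bbs_move[OF Suc]] by simp
qed (use assms in simp)

section \<open>The carrier\<close>

text \<open>
  The balls that jump across the gap between the boxes \<open>j\<close> and \<open>j + 1\<close>.  Defining the carrier by its
  contents, and not by the insertion algorithm, turns the insertion rules into consequences
  of the positions before and after the move.
\<close>

definition carrier :: "nat \<Rightarrow> (int \<Rightarrow> nat) \<Rightarrow> (int \<Rightarrow> nat) \<Rightarrow> int \<Rightarrow> nat set" where
  "carrier n X Y j = {c \<in> {1..n}. ball_pos X c \<le> j \<and> j < ball_pos Y c}"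

lemma finite_carrier [simp]: "finite (carrier n X Y j)"
  by (simp add: carrier_def)

lemma carrier_subset: "carrier n X Y j \<subseteq> {1..n}"
  by (auto simp: carrier_def)

context bbs_step
begin

abbreviation C where "C \<equiv> carrier n X Y"

lemma ball_enters: "X j \<le> n \<Longrightarrow> X j \<in> C j"
  using moves_right[of "X j"] ball_pos_of_ball[OF before, of j] configuration_range[OF before, of j]
  by (auto simp: carrier_def)

lemma ball_leaves: "Y j \<le> n \<Longrightarrow> Y j \<in> C (j - 1)"
  using moves_right[of "Y j"] ball_pos_of_ball[OF after, of j] configuration_range[OF after, of j]
  by (auto simp: carrier_def)

lemma carrier_exchange: "C j - {X j} = C (j - 1) - {Y j}"
proof -
  have "c \<in> C j \<and> c \<noteq> X j \<longleftrightarrow> c \<in> C (j - 1) \<and> c \<noteq> Y j" if "c \<in> {1..n}" for c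
    using that ball_pos_eq_iff[OF before that, of j] ball_pos_eq_iff[OF after that, of j]
      moves_right[OF that]
    by (auto simp: carrier_def)
  then show ?thesis using carrier_subset[of n X Y] by blast
qed

text \<open>
  The next two lemmas are the bumping rule: the ball dropped in box \<open>j\<close> is the smallest ball of the
  carrier larger than the ball picked up there, or the smallest ball at all if the box was empty.
  The reason is that box \<open>j\<close> becomes free only when its old ball jumps, and the first ball of the
  carrier that comes by afterwards takes it.
\<close>

lemma leaving_is_larger: "Y j \<le> n \<Longrightarrow> X j < Y j \<or> X j = n + 1"
  using lands_on_free[of "Y j"] ball_pos_of_ball[OF after, of j] configuration_range[OF after, of j]
  by auto

lemma leaving_is_first:
  assumes "c \<in> C (j - 1)"
  shows "Y j \<le> c \<or> c < X j \<and> X j \<le> n"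
proof (cases "ball_pos Y c = j")
  case True
  then show ?thesis using ball_at_ball_pos[OF after, of c] assms by (auto simp: carrier_def)
next
  case False
  then show ?thesis using skips_occupied[of c j] assms by (auto simp: carrier_def)
qed

end

section \<open>The number of runs is preserved\<close>

definition run_starts :: "nat \<Rightarrow> (int \<Rightarrow> nat) \<Rightarrow> int set" where
  "run_starts n X = {i. X i \<le> n \<and> \<not> X (i - 1) < X i}"

definition run_ends :: "nat \<Rightarrow> (int \<Rightarrow> nat) \<Rightarrow> int set" where
  "run_ends n X = {i. X i \<le> n \<and> \<not> (X i < X (i + 1) \<and> X (i + 1) \<le> n)}"

text \<open>
  Moving one box to the left maps the balls that do not start a run bijectively to the balls that do
  not end one.
\<close>

lemma card_run_ends:
  assumes "configuration n X"
  shows "card (run_ends n X) = card (run_starts n X)"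
proof -
  define B where "B = {i. X i \<le> n}"
  have fin: "finite B" unfolding B_def by (rule finite_balls[OF assms])
  have sub: "run_starts n X \<subseteq> B" "run_ends n X \<subseteq> B"
    by (auto simp: B_def run_starts_def run_ends_def)
  have "B - run_starts n X = (\<lambda>i. i + 1) ` (B - run_ends n X)"
  proof (intro equalityI subsetI)
    fix i assume "i \<in> B - run_starts n X"
    then have "i - 1 \<in> B - run_ends n X" by (auto simp: B_def run_starts_def run_ends_def)
    then show "i \<in> (\<lambda>i. i + 1) ` (B - run_ends n X)" by force
  qed (auto simp: B_def run_starts_def run_ends_def)
  then have "card (B - run_starts n X) = card (B - run_ends n X)"
    by (simp add: card_image)
  then have "card B - card (run_starts n X) = card B - card (run_ends n X)"
    using sub fin by (simp add: card_Diff_subset finite_subset)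
  moreover have "card (run_starts n X) \<le> card B" "card (run_ends n X) \<le> card B"
    using sub fin by (auto intro: card_mono)
  ultimately show ?thesis by linarith
qed

context bbs_step
begin

text \<open>
  The row bumping lemma.  If a run of \<open>X\<close> ends in box \<open>j\<close>, then \<open>X j\<close> is in the carrier and still
  eligible for box \<open>j + 1\<close>, so \<open>Y (j + 1) \<le> X j < Y j\<close>.  Otherwise a ball dropped in box \<open>j + 1\<close> was
  also eligible for box \<open>j\<close>, and the smaller value went to box \<open>j\<close>.
\<close>

lemma descent_iff_run_end: "Y (j + 1) < Y j \<longleftrightarrow> j \<in> run_ends n X"
proof
  assume "j \<in> run_ends n X"
  then have x: "X j \<le> n" and x': "X (j + 1) \<le> n \<Longrightarrow> X (j + 1) \<le> X j"
    by (auto simp: run_ends_def)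
  have "Y (j + 1) \<le> X j"
    using leaving_is_first[of "X j" "j + 1"] ball_enters[OF x] x' by auto
  also have "X j < Y j"
    using leaving_is_larger[of j] x by (cases "Y j \<le> n") auto
  finally show "Y (j + 1) < Y j" .
next
  assume less: "Y (j + 1) < Y j"
  then have ball: "Y (j + 1) \<le> n" using configuration_range[OF after, of j] by simp
  show "j \<in> run_ends n X"
  proof (rule ccontr)
    assume "j \<notin> run_ends n X"
    then have "n < X j \<or> X j < X (j + 1) \<and> X (j + 1) \<le> n"
      by (auto simp: run_ends_def)
    then have bigger: "X j = n + 1 \<or> X j < Y (j + 1)"
      using leaving_is_larger[OF ball] configuration_range[OF before, of j] by auto
    then have "Y (j + 1) \<in> C j - {X j}"
      using ball_leaves[OF ball] ball by auto
    then have "Y (j + 1) \<in> C (j - 1)" using carrier_exchange[of j] by auto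
    from leaving_is_first[OF this] less bigger show False by auto
  qed
qed

lemma run_starts_after: "run_starts n Y = (\<lambda>j. j + 1) ` run_ends n X"
proof (intro equalityI subsetI)
  fix i assume "i \<in> run_starts n Y"
  then have i: "Y i \<le> n" "\<not> Y (i - 1) < Y i" by (auto simp: run_starts_def)
  moreover have "Y i \<noteq> Y (i - 1)"
    using i ball_pos_of_ball[OF after, of i] ball_pos_of_ball[OF after, of "i - 1"] by auto
  ultimately have "i - 1 \<in> run_ends n X"
    using descent_iff_run_end[of "i - 1"] by simp
  then show "i \<in> (\<lambda>j. j + 1) ` run_ends n X" by force
next
  fix i assume "i \<in> (\<lambda>j. j + 1) ` run_ends n X"
  then have "Y i < Y (i - 1)" using descent_iff_run_end[of "i - 1"] by auto
  moreover have "Y (i - 1) \<le> n + 1" using configuration_range[OF after] by auto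
  ultimately show "i \<in> run_starts n Y" by (auto simp: run_starts_def)
qed

lemma card_run_starts_after: "card (run_starts n Y) = card (run_starts n X)"
  using card_run_ends[OF before] by (simp add: run_starts_after card_image)

end

lemma card_run_starts_bbs_moves:
  assumes "configuration n X"
  shows "card (run_starts n ((bbs_move n ^^ t) X)) = card (run_starts n X)"
proof (induction t)
  case (Suc t)
  then show ?case
    using bbs_step.card_run_starts_after[OF bbs_step_bbs_move[OF configuration_bbs_moves[OF assms]]]
    by simp
qed simp

section \<open>Increasing subsequences with a penalty for empty boxes\<close>

definition empties :: "nat \<Rightarrow> (int \<Rightarrow> nat) \<Rightarrow> int set \<Rightarrow> nat" where
  "empties n X W = card {i \<in> W. X i = n + 1}"

text \<open>
  Some window of boxes contains an increasing subsequence of balls, in the boxes \<open>S\<close>, that is longer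
  by at least \<open>m\<close> than the number of empty boxes of the window.  The condition has no preferred
  direction, which makes it suitable for both the carrier and the reverse carrier.
\<close>

definition increasing_excess :: "nat \<Rightarrow> (int \<Rightarrow> nat) \<Rightarrow> nat \<Rightarrow> bool" where
  "increasing_excess n X m \<longleftrightarrow>
     (\<exists>a b S. S \<subseteq> {a..b} \<and> (\<forall>i\<in>S. X i \<le> n) \<and> strict_mono_on S X \<and>
        m + empties n X {a..b} \<le> card S)"

lemma empties_insert:
  assumes "finite W" and "a \<notin> W"
  shows "empties n X (insert a W) = empties n X W + (if X a = n + 1 then 1 else 0)"
proof -
  have "{i \<in> insert a W. X i = n + 1} =
      (if X a = n + 1 then insert a {i \<in> W. X i = n + 1} else {i \<in> W. X i = n + 1})"
    by auto
  then show ?thesis using assms by (simp add: empties_def)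
qed

lemma increasing_excess_run:
  assumes "increasing_run n X r"
  shows "increasing_excess n X (length r)"
proof -
  obtain a b where ab: "increasing_block n X a b" "r = map X [a..b]"
    using assms unfolding increasing_run_def by blast
  have "X i \<noteq> n + 1" if "i \<in> {a..b}" for i
    using ab(1) that unfolding increasing_block_def by force
  then have "{i \<in> {a..b}. X i = n + 1} = {}" by blast
  then have "empties n X {a..b} = 0" unfolding empties_def by (simp only: card.empty)
  then show ?thesis
    using ab unfolding increasing_excess_def increasing_block_def
    by (intro exI[of _ a] exI[of _ b] exI[of _ "{a..b}"]) auto
qed

context bbs_step
begin

text \<open>
  For the carrier travelling from right to left, the ball picked up in box \<open>j\<close> is \<open>Y j\<close> and the one
  dropped, if any, is \<open>X j < Y j\<close>; so no ball of size at least \<open>Y j\<close> is dropped.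
\<close>

lemma larger_stay:
  assumes "Y j \<le> n" and "Y j \<le> v"
  shows "{c \<in> C j. v \<le> c} \<subseteq> C (j - 1)"
proof
  fix c assume c: "c \<in> {c \<in> C j. v \<le> c}"
  then have "c \<le> n" using carrier_subset[of n X Y j] by auto
  with leaving_is_larger[OF assms(1)] c assms(2) have "c \<noteq> X j" by auto
  with c have "c \<in> C j - {X j}" by simp
  then show "c \<in> C (j - 1)" unfolding carrier_exchange by simp
qed

text \<open>
  Read \<open>Y\<close> from right to left and count the balls \<open>\<ge> v\<close> of the reverse carrier.  An empty box lowers
  this count by at most one, which the penalty pays for; a ball never lowers it.  A new first element
  \<open>Y a\<close> of the subsequence adds \<open>Y a\<close> to the carrier and dislodges no larger ball.  The threshold
  \<open>v\<close> is what makes the induction work: the rest of the subsequence is counted above \<open>Y a\<close>.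
\<close>

lemma increasing_subsequence_bound:
  assumes "a \<le> b + 1" and "S \<subseteq> {a..b}" and "\<forall>i\<in>S. v \<le> Y i \<and> Y i \<le> n"
    and "strict_mono_on S Y"
  shows "card S \<le> card {c \<in> C (a - 1). v \<le> c} + empties n Y {a..b}"
  using assms
proof (induction a arbitrary: S v rule: int_le_induct)
  case base
  then show ?case by simp
next
  case (step i)
  define a where "a = i - 1"
  have i: "i = a + 1" by (simp add: a_def)
  have window: "{a..b} = insert a {i..b}" using step.hyps by (auto simp: a_def)
  have emp: "empties n Y {a..b} = empties n Y {i..b} + (if Y a = n + 1 then 1 else 0)"
    unfolding window by (rule empties_insert) (auto simp: a_def)
  have S: "S \<subseteq> insert a {i..b}" using step.prems(1) by (simp add: a_def[symmetric] window)
  have fin: "finite S" using S finite_subset by blast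
  have rest: "card (S - {a}) \<le> card {c \<in> C a. u \<le> c} + empties n Y {i..b}"
    if "\<forall>j\<in>S - {a}. u \<le> Y j" for u
  proof -
    have "S - {a} \<subseteq> {i..b}" using S by auto
    moreover have "strict_mono_on (S - {a}) Y"
      using step.prems(3) by (rule monotone_on_subset) auto
    ultimately show ?thesis
      using step.IH[of "S - {a}" u] that step.prems(2) by (auto simp: i)
  qed
  have before_a: "i - 1 - 1 = a - 1" by (simp add: a_def)
  show ?case unfolding before_a a_def[symmetric]
  proof (cases "a \<in> S")
    case True
    then have y: "v \<le> Y a" "Y a \<le> n" using step.prems(2) by auto
    have "\<forall>j\<in>S - {a}. Suc (Y a) \<le> Y j"
    proof
      fix j assume j: "j \<in> S - {a}"
      then have "a < j" using S by (auto simp: i)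
      then show "Suc (Y a) \<le> Y j"
        using strict_mono_onD[OF step.prems(3), of a j] True j by auto
    qed
    note le = rest[OF this]
    have "{c \<in> C a. Suc (Y a) \<le> c} \<subseteq> C (a - 1)"
      using larger_stay[OF y(2), of "Suc (Y a)"] by simp
    then have "insert (Y a) {c \<in> C a. Suc (Y a) \<le> c} \<subseteq> {c \<in> C (a - 1). v \<le> c}"
      using ball_leaves[OF y(2)] y(1) by auto
    then have "card (insert (Y a) {c \<in> C a. Suc (Y a) \<le> c}) \<le> card {c \<in> C (a - 1). v \<le> c}"
      by (intro card_mono) auto
    moreover have "card (insert (Y a) {c \<in> C a. Suc (Y a) \<le> c})
        = Suc (card {c \<in> C a. Suc (Y a) \<le> c})"
      by (rule card_insert_disjoint) auto
    moreover have "card S = Suc (card (S - {a}))"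
      by (rule card.remove[OF fin True])
    ultimately show "card S \<le> card {c \<in> C (a - 1). v \<le> c} + empties n Y {a..b}"
      using le emp by linarith
  next
    case False
    then have le: "card S \<le> card {c \<in> C a. v \<le> c} + empties n Y {i..b}"
      using rest[of v] step.prems(2) by simp
    show "card S \<le> card {c \<in> C (a - 1). v \<le> c} + empties n Y {a..b}"
    proof (cases "Y a = n + 1")
      case True
      have "{c \<in> C a. v \<le> c} \<subseteq> insert (X a) {c \<in> C (a - 1). v \<le> c}"
        using carrier_exchange[of a] by auto
      then have "card {c \<in> C a. v \<le> c} \<le> card (insert (X a) {c \<in> C (a - 1). v \<le> c})"
        by (intro card_mono) auto
      also have "\<dots> \<le> Suc (card {c \<in> C (a - 1). v \<le> c})" by (simp add: card_insert_if)
      finally show ?thesis using le emp True by simp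
    next
      case F: False
      then have y: "Y a \<le> n" using configuration_range[OF after, of a] by simp
      let ?V = "{c \<in> C (a - 1). v \<le> c}"
      have "card {c \<in> C a. v \<le> c} \<le> card ?V"
      proof (cases "v \<le> Y a")
        case True
        have "{c \<in> C a. v \<le> c} \<subseteq> insert (X a) (?V - {Y a})"
          using carrier_exchange[of a] by auto
        then have "card {c \<in> C a. v \<le> c} \<le> card (insert (X a) (?V - {Y a}))"
          by (intro card_mono) auto
        also have "\<dots> \<le> Suc (card (?V - {Y a}))" by (simp add: card_insert_if)
        also have "\<dots> = card ?V"
          using ball_leaves[OF y] True by (intro card_Suc_Diff1) auto
        finally show ?thesis .
      next
        case False
        then have "{c \<in> C a. v \<le> c} \<subseteq> ?V"
          using larger_stay[OF y, of v] by auto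
        then show ?thesis by (intro card_mono) auto
      qed
      then show ?thesis using le emp F by simp
    qed
  qed
qed

lemma increasing_excess_carrier:
  assumes "increasing_excess n Y m"
  shows "\<exists>j. m \<le> card (C j)"
proof -
  obtain a b S where S: "S \<subseteq> {a..b}" "\<forall>i\<in>S. Y i \<le> n" "strict_mono_on S Y"
    and m: "m + empties n Y {a..b} \<le> card S"
    using assms unfolding increasing_excess_def by blast
  show ?thesis
  proof (cases "a \<le> b + 1")
    case True
    from increasing_subsequence_bound[OF this S(1) _ S(3), of 0] S(2) m
    have "m \<le> card (C (a - 1))" by simp
    then show ?thesis ..
  next
    case False
    then have "S = {}" using S(1) by auto
    then show ?thesis using m by simp
  qed
qed

text \<open>
  For the forward carrier the balls \<open>\<le> v\<close> are counted.  The following three lemmas express how this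
  count changes at box \<open>j\<close>: an empty box removes the smallest ball, and a ball \<open>X j\<close> raises the count
  only if it is at most \<open>v\<close> and bumps nothing up to \<open>v\<close>, in which case the balls \<open>\<le> v\<close> in the carrier
  before it are all smaller than \<open>X j\<close>.
\<close>

lemma low_balls_after_empty:
  assumes x: "X j = n + 1" and "{c \<in> C j. c \<le> v} \<noteq> {}"
  shows "Suc (card {c \<in> C j. c \<le> v}) \<le> card {c \<in> C (j - 1). c \<le> v}"
proof -
  obtain c where c: "c \<in> C j" "c \<le> v" using assms(2) by auto
  have "n + 1 \<notin> C j" using carrier_subset[of n X Y j] by auto
  then have C: "C j = C (j - 1) - {Y j}" using carrier_exchange[of j] x by simp
  then have "c \<in> C (j - 1)" using c by simp
  from leaving_is_first[OF this] x have "Y j \<le> c" by simp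
  moreover have "c \<le> n" using c carrier_subset[of n X Y j] by auto
  ultimately have "Y j \<in> {c \<in> C (j - 1). c \<le> v}"
    using ball_leaves[of j] c by simp
  moreover have "{c \<in> C j. c \<le> v} = {c \<in> C (j - 1). c \<le> v} - {Y j}"
    unfolding C by blast
  ultimately show ?thesis
    using card_Suc_Diff1[of "{c \<in> C (j - 1). c \<le> v}" "Y j"] by simp
qed

lemma low_balls_no_gain:
  assumes "v \<le> n" and "v < X j \<or> Y j \<le> v"
  shows "card {c \<in> C j. c \<le> v} \<le> card {c \<in> C (j - 1). c \<le> v}"
proof (cases "v < X j")
  case True
  have "{c \<in> C j. c \<le> v} \<subseteq> C j - {X j}" using True by auto
  then have "{c \<in> C j. c \<le> v} \<subseteq> {c \<in> C (j - 1). c \<le> v}"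
    unfolding carrier_exchange by blast
  then show ?thesis by (intro card_mono) simp_all
next
  case False
  let ?V = "{c \<in> C (j - 1). c \<le> v}"
  have y: "Y j \<in> ?V" using ball_leaves[of j] False assms by simp
  have "{c \<in> C j. c \<le> v} \<subseteq> insert (X j) ({c \<in> C j - {X j}. c \<le> v})" by blast
  also have "\<dots> \<subseteq> insert (X j) (?V - {Y j})"
    unfolding carrier_exchange by blast
  finally have "card {c \<in> C j. c \<le> v} \<le> card (insert (X j) (?V - {Y j}))"
    by (intro card_mono) simp_all
  also have "\<dots> \<le> Suc (card (?V - {Y j}))" by (rule card_insert_le_m1) simp_all
  also have "\<dots> = card ?V" using y by (intro card_Suc_Diff1) simp_all
  finally show ?thesis .
qed

lemma low_balls_append:
  assumes "X j \<le> v" and "v < Y j"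
  shows "card {c \<in> C j. c \<le> v} \<le> Suc (card {c \<in> C (j - 1). c \<le> X j - 1})"
proof -
  have "{c \<in> C j. c \<le> v} \<subseteq> insert (X j) {c \<in> C (j - 1). c \<le> X j - 1}"
  proof
    fix c assume c: "c \<in> {c \<in> C j. c \<le> v}"
    show "c \<in> insert (X j) {c \<in> C (j - 1). c \<le> X j - 1}"
    proof (cases "c = X j")
      case False
      then have "c \<in> C j - {X j}" using c by simp
      then have "c \<in> C (j - 1)" unfolding carrier_exchange by simp
      with leaving_is_first[OF this] c assms show ?thesis by auto
    qed simp
  qed
  then have "card {c \<in> C j. c \<le> v} \<le> card (insert (X j) {c \<in> C (j - 1). c \<le> X j - 1})"
    by (intro card_mono) simp_all
  also have "\<dots> \<le> Suc (card {c \<in> C (j - 1). c \<le> X j - 1})"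
    by (rule card_insert_le_m1) simp_all
  finally show ?thesis .
qed

text \<open>
  By the recursion for the number of balls \<open>\<le> v\<close>, this number is realised by an increasing subsequence
  with values \<open>\<le> v\<close> in a window ending at \<open>j\<close>: whenever the count rises, append the ball \<open>X j\<close> to a
  subsequence with values below \<open>X j\<close>.  When the count is zero, start again with the empty window.
\<close>

lemma carrier_increasing_subsequence:
  assumes "v \<le> n"
  shows "\<exists>a S. a \<le> j + 1 \<and> S \<subseteq> {a..j} \<and> (\<forall>i\<in>S. X i \<le> v \<and> X i \<le> n) \<and> strict_mono_on S X \<and>
     card {c \<in> C j. c \<le> v} + empties n X {a..j} \<le> card S"
proof -
  have trivial: "\<exists>a S. a \<le> j + 1 \<and> S \<subseteq> {a..j} \<and> (\<forall>i\<in>S. X i \<le> v \<and> X i \<le> n) \<and> strict_mono_on S X \<and>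
     card {c \<in> C j. c \<le> v} + empties n X {a..j} \<le> card S" if "{c \<in> C j. c \<le> v} = {}" for j v
  proof -
    have "empties n X {j + 1..j} = 0" by (simp add: empties_def)
    then show ?thesis
      unfolding that by (intro exI[of _ "j + 1"] exI[of _ "{}"]) (simp add: monotone_on_def)
  qed
  obtain L R where L: "\<And>i. X i \<le> n \<Longrightarrow> L < i \<and> i < R"
    using balls_bounded[OF before] by metis
  have empty: "C j = {}" if "j \<le> L" for j
  proof -
    have "\<not> ball_pos X c \<le> j" if "c \<in> {1..n}" for c
      using L[of "ball_pos X c"] ball_at_ball_pos[OF before that] that \<open>j \<le> L\<close> by simp
    then show ?thesis by (auto simp: carrier_def)
  qed
  show ?thesis
  proof (cases "L \<le> j")
    case False
    then show ?thesis using empty by (intro trivial) simp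
  next
    case True
    then show ?thesis using assms
    proof (induction j arbitrary: v rule: int_ge_induct)
      case base
      show ?case using empty by (intro trivial) simp
    next
      case (step i)
      define j where "j = i + 1"
      have i: "i = j - 1" by (simp add: j_def)
      let ?N = "{c \<in> C j. c \<le> v}"
      have window: "{a..j} = insert j {a..i}" if "a \<le> j" for a
        using that by (auto simp: j_def)
      have emp: "empties n X {a..j} = empties n X {a..i} + (if X j = n + 1 then 1 else 0)"
        if "a \<le> j" for a
        unfolding window[OF that] by (rule empties_insert) (auto simp: j_def)
      have keep: ?case
        if le: "card ?N + (if X j = n + 1 then 1 else 0) \<le> card {c \<in> C i. c \<le> v}"
      proof -
        obtain a S where "a \<le> i + 1" "S \<subseteq> {a..i}" "\<forall>k\<in>S. X k \<le> v \<and> X k \<le> n"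
          "strict_mono_on S X" "card {c \<in> C i. c \<le> v} + empties n X {a..i} \<le> card S"
          using step.IH[of v] step.prems by blast
        then show ?thesis
          unfolding j_def[symmetric] using emp[of a] le
          by (intro exI[of _ a] exI[of _ S]) (auto simp: j_def)
      qed
      show ?case
      proof (cases "?N = {}")
        case True
        then show ?thesis unfolding j_def by (rule trivial)
      next
        case nonempty: False
        show ?thesis
        proof (cases "X j = n + 1")
          case True
          from low_balls_after_empty[OF this nonempty]
          have "Suc (card ?N) \<le> card {c \<in> C i. c \<le> v}" unfolding i .
          then show ?thesis using True by (intro keep) simp
        next
          case ball: False
          then have x: "X j \<le> n" using configuration_range[OF before, of j] by simp
          show ?thesis
          proof (cases "X j \<le> v \<and> v < Y j")
            case False
            then have "card ?N \<le> card {c \<in> C i. c \<le> v}"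
              unfolding i using step.prems by (intro low_balls_no_gain) auto
            then show ?thesis using ball by (intro keep) simp
          next
            case True
            then have le: "card ?N \<le> Suc (card {c \<in> C i. c \<le> X j - 1})"
              unfolding i by (intro low_balls_append) simp_all
            have pred: "X j - 1 \<le> n" using x by simp
            obtain a S where a: "a \<le> i + 1" and S: "S \<subseteq> {a..i}"
              "\<forall>k\<in>S. X k \<le> X j - 1 \<and> X k \<le> n" "strict_mono_on S X"
              and bound: "card {c \<in> C i. c \<le> X j - 1} + empties n X {a..i} \<le> card S"
              using step.IH[OF pred] by blast
            have fin: "finite S" using S(1) finite_subset by blast
            have new: "j \<notin> S" using S(1) by (auto simp: j_def)
            have "strict_mono_on (insert j S) X"
            proof (rule strict_mono_onI)
              fix r s assume rs: "r \<in> insert j S" "s \<in> insert j S" "r < s"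
              then have "r \<in> S" using S(1) by (auto simp: j_def)
              show "X r < X s"
              proof (cases "s = j")
                case True
                then show ?thesis
                  using S(2) \<open>r \<in> S\<close> configuration_range[OF before, of j] by fastforce
              next
                case False
                then show ?thesis
                  using strict_mono_onD[OF S(3)] rs \<open>r \<in> S\<close> by auto
              qed
            qed
            moreover have "insert j S \<subseteq> {a..j}" using S(1) a by (auto simp: j_def)
            moreover have "\<forall>k\<in>insert j S. X k \<le> v \<and> X k \<le> n"
              using S(2) True x by auto
            moreover have "card ?N + empties n X {a..j} \<le> card (insert j S)"
              using le bound fin new emp[of a] a ball by (simp add: j_def)
            ultimately show ?thesis
              unfolding j_def[symmetric] using a
              by (intro exI[of _ a] exI[of _ "insert j S"]) (auto simp: j_def)
          qed
        qed
      qed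
    qed
  qed
qed

lemma carrier_increasing_excess: "increasing_excess n X (card (C j))"
proof -
  have "{c \<in> C j. c \<le> n} = C j" using carrier_subset[of n X Y j] by auto
  then show ?thesis
    using carrier_increasing_subsequence[of n j] unfolding increasing_excess_def by auto
qed

end

lemma increasing_excess_bbs_moves:
  assumes "configuration n X" and "increasing_excess n ((bbs_move n ^^ t) X) m"
  shows "increasing_excess n X m"
  using assms(2)
proof (induction t)
  case (Suc t)
  interpret bbs_step n "(bbs_move n ^^ t) X" "(bbs_move n ^^ Suc t) X"
    using bbs_step_bbs_move[OF configuration_bbs_moves[OF assms(1)]] by simp
  obtain j where j: "m \<le> card (C j)" using increasing_excess_carrier[OF Suc.prems] by blast
  have "increasing_excess n ((bbs_move n ^^ t) X) m"
    using carrier_increasing_excess[of j] j unfolding increasing_excess_def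
    by (meson add_le_mono1 le_trans)
  then show ?case by (rule Suc.IH)
qed simp

section \<open>Runs, their first and last boxes\<close>

text \<open>
  Maximality of a block is a condition on its two ends only; the two lemmas below translate
  between increasing runs and their first and last boxes.
\<close>

lemma increasing_run_of_block:
  assumes "increasing_block n X a b" and "a \<in> run_starts n X" and "b \<in> run_ends n X"
  shows "increasing_run n X (map X [a..b])"
  unfolding increasing_run_def
proof (intro exI conjI allI impI)
  fix a' b' assume "increasing_block n X a' b' \<and> a' \<le> a \<and> b \<le> b'"
  then have blk: "\<forall>i\<in>{a'..b'}. X i \<in> {1..n}" "strict_mono_on {a'..b'} X"
    and le: "a' \<le> a" "b \<le> b'"
    by (auto simp: increasing_block_def)
  have "a \<le> b" using assms(1) by (simp add: increasing_block_def)
  have "\<not> a' < a"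
  proof
    assume "a' < a"
    then have "X (a - 1) < X a"
      using le \<open>a \<le> b\<close> by (intro strict_mono_onD[OF blk(2)]) auto
    then show False using assms(2) by (simp add: run_starts_def)
  qed
  then show "a' = a" using le by simp
  have "\<not> b < b'"
  proof
    assume "b < b'"
    then have "X b < X (b + 1)" "b + 1 \<in> {a'..b'}"
      using le \<open>a \<le> b\<close> by (auto intro!: strict_mono_onD[OF blk(2)])
    then show False using assms(3) blk(1) by (auto simp: run_ends_def)
  qed
  then show "b' = b" using le by simp
qed (use assms(1) in auto)

lemma increasing_run_start:
  assumes X: "configuration n X" and "increasing_run n X r"
  obtains a b where "a \<le> b" and "r = map X [a..b]" and "a \<in> run_starts n X"
    and "\<forall>i\<in>{a..b}. X i \<in> {1..n}"
proof -
  obtain a b where blk: "increasing_block n X a b"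
    and maxi: "\<And>a' b'. increasing_block n X a' b' \<Longrightarrow> a' \<le> a \<Longrightarrow> b \<le> b' \<Longrightarrow> a' = a"
    and r: "r = map X [a..b]"
    using assms(2) unfolding increasing_run_def by blast
  have ab: "a \<le> b" and balls: "\<forall>i\<in>{a..b}. X i \<in> {1..n}" and mono: "strict_mono_on {a..b} X"
    using blk by (auto simp: increasing_block_def)
  have "\<not> X (a - 1) < X a"
  proof
    assume less: "X (a - 1) < X a"
    have window: "{a - 1..b} = insert (a - 1) {a..b}" using ab by auto
    have "X i < X j" if "i \<in> {a - 1..b}" "j \<in> {a - 1..b}" "i < j" for i j
    proof (cases "i = a - 1")
      case True
      have "X a \<le> X j"
      proof (cases "j = a")
        case False
        then have "X a < X j" using that True ab by (intro strict_mono_onD[OF mono]) auto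
        then show ?thesis by simp
      qed simp
      then show ?thesis using less True by simp
    next
      case False
      then show ?thesis using that by (intro strict_mono_onD[OF mono]) auto
    qed
    then have "strict_mono_on {a - 1..b} X" by (rule strict_mono_onI)
    moreover have "X a \<in> {1..n}" using ab balls by auto
    then have "X (a - 1) \<in> {1..n}" using less configuration_range[OF X, of "a - 1"] by auto
    ultimately have "increasing_block n X (a - 1) b"
      using ab balls unfolding increasing_block_def window by simp
    then show False using maxi[of "a - 1" b] by simp
  qed
  moreover have "X a \<le> n" using ab balls by auto
  ultimately have "a \<in> run_starts n X" by (simp add: run_starts_def)
  with ab r balls show ?thesis by (intro that) auto
qed

text \<open>
  The solitons are runs with distinct first balls, so there are at most as many as starts of runs.
\<close>

lemma length_soliton_rows:
  assumes X: "configuration n X" and rows: "soliton_rows n X T"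
  shows "length T \<le> card (run_starts n X)"
proof -
  have start: "r \<noteq> [] \<and> hd r \<in> X ` run_starts n X" if "r \<in> set T" for r
  proof -
    have "soliton n X r" using that rows by (auto simp: soliton_rows_def)
    then have "increasing_run n X r" unfolding soliton_def by (metis funpow_0)
    then obtain a b where "a \<le> b" "r = map X [a..b]" "a \<in> run_starts n X"
      by (rule increasing_run_start[OF X])
    then show ?thesis by (simp add: upto_rec1)
  qed
  have "sorted_wrt (\<lambda>r s. ball_pos X (hd s) < ball_pos X (hd r)) T"
    using rows by (simp add: soliton_rows_def)
  then have "distinct (map hd T)"
    by (induction T) force+
  then have "length T = card (set (map hd T))"
    using distinct_card by fastforce
  also have "\<dots> \<le> card (X ` run_starts n X)"
  proof (rule card_mono)
    have "run_starts n X \<subseteq> {i. X i \<le> n}" by (auto simp: run_starts_def)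
    then show "finite (X ` run_starts n X)" using finite_balls[OF X] finite_subset by blast
    show "set (map hd T) \<subseteq> X ` run_starts n X" using start by auto
  qed
  also have "\<dots> \<le> card (run_starts n X)"
  proof (rule card_image_le)
    have "run_starts n X \<subseteq> {i. X i \<le> n}" by (auto simp: run_starts_def)
    then show "finite (run_starts n X)" using finite_balls[OF X] finite_subset by blast
  qed
  finally show ?thesis .
qed

lemma balls_le_sum_tableau_shape:
  assumes "steady_state n X" and "soliton_rows n X T"
  shows "n \<le> sum_list (tableau_shape T)"
proof -
  have "{1..n} \<subseteq> set (concat T)"
    using assms unfolding steady_state_def soliton_rows_def by auto
  then have "card {1..n} \<le> card (set (concat T))" by (rule card_mono[rotated]) simp
  also have "\<dots> \<le> length (concat T)" by (rule card_length)
  finally show ?thesis by (simp add: length_concat tableau_shape_def)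
qed

section \<open>Single balls followed by one run\<close>

text \<open>
  The run in question starts in box \<open>m\<close> and carries the set \<open>A\<close> of balls: each ball up to box \<open>m\<close>
  starts a run of its own, and no run starts further to the right, so all balls from box \<open>m\<close> on
  are consecutive and increasing.
\<close>

definition singles_then_run :: "nat \<Rightarrow> nat set \<Rightarrow> (int \<Rightarrow> nat) \<Rightarrow> bool" where
  "singles_then_run n A X \<longleftrightarrow> configuration n X \<and>
     (\<exists>m. X m \<le> n \<and> run_starts n X = {i. i \<le> m \<and> X i \<le> n} \<and> X ` {i. m \<le> i \<and> X i \<le> n} = A)"

lemma last_run_block:
  assumes X: "configuration n X" and m: "X m \<le> n"
    and starts: "run_starts n X = {i. i \<le> m \<and> X i \<le> n}"
  obtains M where "m \<le> M" and "\<And>i. m \<le> i \<Longrightarrow> X i \<le> n \<longleftrightarrow> i \<le> M"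
    and "strict_mono_on {m..M} X" and "M \<in> run_ends n X"
proof -
  have fin: "finite {i. X i \<le> n}" by (rule finite_balls[OF X])
  define M where "M = Max {i. X i \<le> n}"
  have mM: "m \<le> M" unfolding M_def using fin m by auto
  have "M \<in> {i. X i \<le> n}" unfolding M_def using fin m by (intro Max_in) auto
  then have XM: "X M \<le> n" by simp
  have le: "i \<le> M" if "X i \<le> n" for i unfolding M_def using fin that by auto
  have prev: "X (i - 1) < X i" if "m < i" "X i \<le> n" for i
  proof -
    have "i \<notin> run_starts n X" using that starts by simp
    then show ?thesis using that by (simp add: run_starts_def)
  qed
  have ball: "X i \<le> n" if "i \<le> M" "m \<le> i" for i
    using that
  proof (induction i rule: int_le_induct)
    case base
    then show ?case using XM by simp
  next
    case (step i)
    then show ?case using prev[of i] by simp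
  qed
  have mono: "X r < X s" if "r < s" "m \<le> r" "s \<le> M" for r s
    using that
  proof (induction s rule: int_gr_induct)
    case base
    then show ?case using prev[of "r + 1"] ball[of "r + 1"] by simp
  next
    case (step i)
    then show ?case using prev[of "i + 1"] ball[of "i + 1"] by simp
  qed
  show ?thesis
  proof (rule that[OF mM])
    show "X i \<le> n \<longleftrightarrow> i \<le> M" if "m \<le> i" for i using ball le that by blast
    show "strict_mono_on {m..M} X" using mono by (intro strict_mono_onI) auto
    show "M \<in> run_ends n X" using XM le[of "M + 1"] by (auto simp: run_ends_def)
  qed
qed

lemma single_in_run_ends:
  assumes "run_starts n X = {i. i \<le> m \<and> X i \<le> n}" and "i < m" and "X i \<le> n"
  shows "i \<in> run_ends n X"
proof -
  have "\<not> X i < X (i + 1)" if "X (i + 1) \<le> n"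
  proof -
    have "i + 1 \<in> run_starts n X" using assms that by simp
    then show ?thesis by (simp add: run_starts_def)
  qed
  then show ?thesis using assms(3) by (auto simp: run_ends_def)
qed

lemma singles_then_run_increasing_runs:
  assumes "singles_then_run n A X"
  shows "increasing_run n X (sorted_list_of_set A)"
    and "\<And>b. \<lbrakk>b \<in> {1..n}; b \<notin> A\<rbrakk> \<Longrightarrow> increasing_run n X [b]"
proof -
  obtain m where X: "configuration n X" and m: "X m \<le> n"
    and starts: "run_starts n X = {i. i \<le> m \<and> X i \<le> n}"
    and A: "X ` {i. m \<le> i \<and> X i \<le> n} = A"
    using assms unfolding singles_then_run_def by blast
  obtain M where mM: "m \<le> M" and win: "\<And>i. m \<le> i \<Longrightarrow> X i \<le> n \<longleftrightarrow> i \<le> M"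
    and mono: "strict_mono_on {m..M} X" and M: "M \<in> run_ends n X"
    using last_run_block[OF X m starts] by blast
  have balls: "X i \<in> {1..n}" if "i \<in> {m..M}" for i
    using that win[of i] configuration_range[OF X, of i] by simp
  have "increasing_block n X m M"
    using mM mono balls by (simp add: increasing_block_def)
  then have "increasing_run n X (map X [m..M])"
    by (rule increasing_run_of_block) (use starts m M in simp_all)
  moreover have "sorted_list_of_set A = map X [m..M]"
  proof -
    have "sorted_wrt (\<lambda>i j. X i < X j) [m..M]"
      by (rule sorted_wrt_mono_rel[OF _ sorted_wrt_upto])
        (auto intro: strict_mono_onD[OF mono])
    then have "sorted_wrt (<) (map X [m..M])" by (simp add: sorted_wrt_map)
    then have "sorted (map X [m..M])" "distinct (map X [m..M])"
      unfolding strict_sorted_iff by simp_all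
    then have "sorted_list_of_set (set (map X [m..M])) = map X [m..M]"
      by (rule sorted_list_of_set.idem_if_sorted_distinct)
    moreover have "{i. m \<le> i \<and> X i \<le> n} = {m..M}" using win by auto
    then have "set (map X [m..M]) = A" using A by simp
    ultimately show ?thesis by simp
  qed
  ultimately show "increasing_run n X (sorted_list_of_set A)" by simp
  fix b assume b: "b \<in> {1..n}" "b \<notin> A"
  define i where "i = ball_pos X b"
  have Xi: "X i = b" unfolding i_def by (rule ball_at_ball_pos[OF X b(1)])
  then have "\<not> m \<le> i" using b A by auto
  then have "i \<in> run_starts n X" "i \<in> run_ends n X"
    using starts Xi b single_in_run_ends[OF starts, of i] by auto
  moreover have "increasing_block n X i i"
    using Xi b by (simp add: increasing_block_def monotone_on_def)
  ultimately have "increasing_run n X (map X [i..i])" by (intro increasing_run_of_block)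
  then show "increasing_run n X [b]" using Xi by simp
qed

lemma image_balls_from:
  assumes "configuration n X"
  shows "X ` {i. k \<le> i \<and> X i \<le> n} = {1..n} - X ` {i. i < k \<and> X i \<le> n}"
proof -
  have "{i. k \<le> i \<and> X i \<le> n} = {i. X i \<le> n} - {i. i < k \<and> X i \<le> n}" by auto
  then have "X ` {i. k \<le> i \<and> X i \<le> n} = X ` {i. X i \<le> n} - X ` {i. i < k \<and> X i \<le> n}"
    by (simp only:) (rule inj_on_image_set_diff[OF inj_on_balls[OF assms]], auto)
  then show ?thesis unfolding image_balls[OF assms] .
qed

context bbs_step
begin

text \<open>
  Up to box \<open>m\<close> the carrier drops each ball in the very next box, which is either empty or holds a
  smaller ball.
\<close>

lemma carrier_of_singles:
  assumes starts: "run_starts n X = {i. i \<le> m \<and> X i \<le> n}" and "i \<le> m"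
  shows "C i = {X i} \<inter> {..n} \<and> Y i = X (i - 1)"
proof -
  have next_empty: "C i = {X i} \<inter> {..n} \<and> Y i = X (i - 1)"
    if C: "C (i - 1) = {X (i - 1)} \<inter> {..n}" and i: "i \<le> m" for i
  proof -
    have Y: "Y i = X (i - 1)"
    proof (cases "X (i - 1) \<le> n")
      case True
      have "\<not> (X (i - 1) < X i \<and> X i \<le> n)"
      proof
        assume less: "X (i - 1) < X i \<and> X i \<le> n"
        then have "i \<in> run_starts n X" using starts i by simp
        then show False using less by (simp add: run_starts_def)
      qed
      then have "Y i \<le> X (i - 1)" using leaving_is_first[of "X (i - 1)" i] C True by auto
      then show ?thesis using ball_leaves[of i] C True by simp
    next
      case False
      then have "\<not> Y i \<le> n" using ball_leaves[of i] C by auto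
      then show ?thesis
        using False configuration_range[OF after, of i] configuration_range[OF before, of "i - 1"]
        by simp
    qed
    then have "C i \<subseteq> {X i}" using carrier_exchange[of i] C by auto
    then have "C i = {X i} \<inter> {..n}"
      using ball_enters[of i] carrier_subset[of n X Y i] by (cases "X i \<le> n") auto
    then show ?thesis using Y by simp
  qed
  obtain L R where L: "\<And>i. X i \<le> n \<Longrightarrow> L < i \<and> i < R"
    using balls_bounded[OF before] by metis
  have low: "C i = {X i} \<inter> {..n}" if "i \<le> L" for i
  proof -
    have "\<not> X i \<le> n" using L[of i] that by auto
    moreover have "\<not> ball_pos X c \<le> i" if "c \<in> {1..n}" for c
      using L[of "ball_pos X c"] ball_at_ball_pos[OF before that] that \<open>i \<le> L\<close> by simp
    ultimately show ?thesis by (auto simp: carrier_def)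
  qed
  have C: "C i = {X i} \<inter> {..n}" if "i \<le> m" for i
  proof (cases "L \<le> i")
    case True
    then show ?thesis using that
    proof (induction i rule: int_ge_induct)
      case base
      then show ?case using low by simp
    next
      case (step i)
      then show ?case using next_empty[of "i + 1"] by simp
    qed
  next
    case False
    then show ?thesis using low by simp
  qed
  then show ?thesis using next_empty[of i] assms(2) by simp
qed

text \<open>
  If the last run occupies \<open>m..M\<close>, then its first ball joins an otherwise empty carrier, and its
  other balls are larger than everything already carried, so that nothing is dropped in
  \<open>m + 1..M\<close>.  The last ball of the run is an end of a run, so box \<open>M + 1\<close> receives a ball and is the
  last start of a run.  The single balls are shifted by one box, and the set of the remaining balls
  is still \<open>A\<close>.
\<close>

lemma singles_then_run_after:
  assumes "singles_then_run n A X"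
  shows "singles_then_run n A Y"
proof -
  obtain m where m: "X m \<le> n"
    and starts: "run_starts n X = {i. i \<le> m \<and> X i \<le> n}"
    and A: "X ` {i. m \<le> i \<and> X i \<le> n} = A"
    using assms unfolding singles_then_run_def by blast
  obtain M where mM: "m \<le> M" and win: "\<And>i. m \<le> i \<Longrightarrow> X i \<le> n \<longleftrightarrow> i \<le> M"
    and mono: "strict_mono_on {m..M} X" and M: "M \<in> run_ends n X"
    using last_run_block[OF before m starts] by blast
  note singles = carrier_of_singles[OF starts]
  have inner: "i \<notin> run_ends n X" if "m \<le> i" "i < M" for i
  proof -
    have "X i < X (i + 1)" using that by (intro strict_mono_onD[OF mono]) auto
    moreover have "X (i + 1) \<le> n" using that win[of "i + 1"] by simp
    ultimately show ?thesis by (simp add: run_ends_def)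
  qed
  \<comment> \<open>Box \<open>m + 1\<close> is empty because the carrier holds only \<open>X m < X (m + 1)\<close>; a first ball further to
    the right would be a start of a run of \<open>Y\<close>, but no run of \<open>X\<close> ends just before it.\<close>
  have gap: "Y i = n + 1" if "m + 1 \<le> i" "i \<le> M" for i
    using that
  proof (induction i rule: int_ge_induct)
    case base
    have "\<not> Y (m + 1) \<le> n"
    proof
      assume y: "Y (m + 1) \<le> n"
      then have "Y (m + 1) = X m" using ball_leaves[OF y] singles[of m] by simp
      moreover have "X m < X (m + 1)" using base by (intro strict_mono_onD[OF mono]) auto
      moreover have "X (m + 1) \<le> n" using base win[of "m + 1"] by simp
      ultimately show False using leaving_is_larger[OF y] by auto
    qed
    then show ?case using configuration_range[OF after, of "m + 1"] by simp
  next
    case (step i)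
    have "\<not> Y (i + 1) \<le> n"
    proof
      assume y: "Y (i + 1) \<le> n"
      have "i + 1 \<notin> run_starts n Y"
        using inner[of i] step by (auto simp: run_starts_after)
      then have "Y i < Y (i + 1)" using y by (simp add: run_starts_def)
      then show False using y step by simp
    qed
    then show ?case using configuration_range[OF after, of "i + 1"] by simp
  qed
  have "M + 1 \<in> run_starts n Y" using M by (auto simp: run_starts_after)
  then have YM: "Y (M + 1) \<le> n" by (simp add: run_starts_def)
  have below: "i \<le> m" if "i < M + 1" "Y i \<le> n" for i
    using gap[of i] that by force
  have "run_starts n Y = {i. i \<le> M + 1 \<and> Y i \<le> n}"
  proof (intro equalityI subsetI)
    fix i assume i: "i \<in> run_starts n Y"
    then have "i - 1 \<in> run_ends n X" by (auto simp: run_starts_after)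
    then have "X (i - 1) \<le> n" by (simp add: run_ends_def)
    then have "i - 1 \<le> M" using win[of "i - 1"] mM by linarith
    then show "i \<in> {i. i \<le> M + 1 \<and> Y i \<le> n}" using i by (auto simp: run_starts_def)
  next
    fix i assume i: "i \<in> {i. i \<le> M + 1 \<and> Y i \<le> n}"
    show "i \<in> run_starts n Y"
    proof (cases "i = M + 1")
      case True
      then show ?thesis using \<open>M + 1 \<in> run_starts n Y\<close> by simp
    next
      case False
      then have "i \<le> m" using i below by simp
      then have "i - 1 \<in> run_ends n X"
        using single_in_run_ends[OF starts, of "i - 1"] singles[of i] i by simp
      then have "i - 1 + 1 \<in> run_starts n Y" unfolding run_starts_after by (rule imageI)
      then show ?thesis by simp
    qed
  qed
  moreover have "Y ` {i. i < M + 1 \<and> Y i \<le> n} = X ` {i. i < m \<and> X i \<le> n}"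
  proof (intro equalityI subsetI)
    fix c assume "c \<in> Y ` {i. i < M + 1 \<and> Y i \<le> n}"
    then obtain i where i: "c = Y i" "i < M + 1" "Y i \<le> n" by auto
    then have "Y i = X (i - 1)" "i - 1 < m" using below[of i] singles[of i] by auto
    with i show "c \<in> X ` {i. i < m \<and> X i \<le> n}" by auto
  next
    fix c assume "c \<in> X ` {i. i < m \<and> X i \<le> n}"
    then obtain i where "c = X i" "i < m" "X i \<le> n" by auto
    then have "c = Y (i + 1)" "i + 1 < M + 1" "Y (i + 1) \<le> n"
      using singles[of "i + 1"] mM by auto
    then show "c \<in> Y ` {i. i < M + 1 \<and> Y i \<le> n}" by auto
  qed
  then have "Y ` {i. M + 1 \<le> i \<and> Y i \<le> n} = A"
    using A by (simp only: image_balls_from[OF before] image_balls_from[OF after])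
  ultimately show ?thesis
    using after YM unfolding singles_then_run_def by blast
qed

end

text \<open>
  The words of the runs depend only on \<open>A\<close>: they are the single balls outside \<open>A\<close> and the balls of
  \<open>A\<close> in increasing order.
\<close>

lemma singles_then_run_steady_state:
  assumes "singles_then_run n A X"
  shows "steady_state n X"
proof -
  have inv: "singles_then_run n A ((bbs_move n ^^ t) X)" for t
  proof (induction t)
    case (Suc t)
    then have "configuration n ((bbs_move n ^^ t) X)" by (simp add: singles_then_run_def)
    from bbs_step.singles_then_run_after[OF bbs_step_bbs_move[OF this] Suc] show ?case by simp
  qed (use assms in simp)
  have "finite A" using assms finite_balls[of n X] by (auto simp: singles_then_run_def)
  have "soliton n X (sorted_list_of_set A)"
    using singles_then_run_increasing_runs(1)[OF inv] by (simp add: soliton_def)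
  moreover have "soliton n X [b]" if "b \<in> {1..n}" "b \<notin> A" for b
    using singles_then_run_increasing_runs(2)[OF inv that] by (simp add: soliton_def)
  moreover have "b \<in> set (sorted_list_of_set A)" if "b \<in> A" for b
    using that \<open>finite A\<close> by simp
  moreover have "b \<in> set [b]" for b :: nat by simp
  ultimately show ?thesis unfolding steady_state_def by blast
qed

section \<open>The first move of a permutation\<close>

context bbs_step
begin

context
  assumes packed: "\<And>i. X i \<le> n \<longleftrightarrow> 1 \<le> i \<and> i \<le> int n" and nonempty: "1 \<le> n"
begin

lemma packed_ball_pos:
  assumes "c \<in> {1..n}"
  shows "1 \<le> ball_pos X c \<and> ball_pos X c \<le> int n"
  using packed[of "ball_pos X c"] ball_at_ball_pos[OF before assms] assms by simp

text \<open>
  The carrier gains a ball in each of the boxes \<open>1, \<dots>, n\<close> and drops at most one there; beyond box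
  \<open>n\<close> it only loses balls.
\<close>

lemma packed_carrier_max: "card (C j) \<le> card (C (int n))"
proof (cases "j \<le> int n")
  case True
  then show ?thesis
  proof (induction j rule: int_le_induct)
    case (step i)
    show ?case
    proof (cases "1 \<le> i")
      case True
      then have "X i \<le> n" using packed step.hyps by simp
      have "card (C (i - 1)) \<le> card (insert (Y i) (C (i - 1) - {Y i}))"
        by (rule card_mono) auto
      also have "\<dots> \<le> Suc (card (C (i - 1) - {Y i}))"
        by (rule card_insert_le_m1) simp_all
      also have "\<dots> = Suc (card (C i - {X i}))" unfolding carrier_exchange ..
      also have "\<dots> = card (C i)"
        using ball_enters[OF \<open>X i \<le> n\<close>] by (intro card_Suc_Diff1) simp_all
      finally show ?thesis using step.IH by simp
    next
      case False
      then have "\<not> ball_pos X c \<le> i - 1" if "c \<in> {1..n}" for c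
        using packed_ball_pos[OF that] by linarith
      then have "C (i - 1) = {}" by (auto simp: carrier_def)
      then show ?thesis by simp
    qed
  qed simp
next
  case False
  then have "C j \<subseteq> C (int n)" using packed_ball_pos by (fastforce simp: carrier_def)
  then show ?thesis by (intro card_mono) simp_all
qed

lemma packed_balls_beyond: "Y ` {i. int n < i \<and> Y i \<le> n} = C (int n)"
proof (intro equalityI subsetI)
  fix c assume "c \<in> Y ` {i. int n < i \<and> Y i \<le> n}"
  then obtain i where i: "c = Y i" "int n < i" "Y i \<le> n" by auto
  then have "ball_pos Y c = i" "c \<in> {1..n}"
    using ball_pos_of_ball[OF after, of i] configuration_range[OF after, of i] by auto
  then show "c \<in> C (int n)" using i packed_ball_pos[of c] by (simp add: carrier_def)
next
  fix c assume "c \<in> C (int n)"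
  then have c: "c \<in> {1..n}" "int n < ball_pos Y c" by (simp_all add: carrier_def)
  have "Y (ball_pos Y c) = c" by (rule ball_at_ball_pos[OF after c(1)])
  then show "c \<in> Y ` {i. int n < i \<and> Y i \<le> n}"
    using c by (intro image_eqI[of _ _ "ball_pos Y c"]) simp_all
qed

lemma packed_starts_beyond: "run_starts n Y \<inter> {int n<..} = {int n + 1}"
proof -
  have "int n \<in> run_ends n X"
    using packed[of "int n"] packed[of "int n + 1"] nonempty by (simp add: run_ends_def)
  then have "int n + 1 \<in> run_starts n Y" unfolding run_starts_after by (rule imageI)
  moreover have upper: "i \<le> int n + 1" if "i \<in> run_starts n Y" for i
  proof -
    have "i - 1 \<in> run_ends n X" using that by (auto simp: run_starts_after)
    then show ?thesis using packed[of "i - 1"] by (simp add: run_ends_def)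
  qed
  ultimately show ?thesis
  proof (intro equalityI subsetI)
    fix i assume i: "i \<in> run_starts n Y \<inter> {int n<..}"
    then have "i \<le> int n + 1" using upper by blast
    with i show "i \<in> {int n + 1}" by simp
  qed simp
qed

text \<open>
  Counting.  The last run has at least \<open>s\<close> balls, so at most \<open>n - s\<close> balls lie to its left.  By
  hypothesis they contain at least \<open>n - s\<close> starts of runs, so each of them is a start.
\<close>

lemma packed_singles_then_run:
  assumes excess: "increasing_excess n Y s" and many: "n < s + card (run_starts n Y)"
  shows "\<exists>A. singles_then_run n A Y"
proof -
  define B where "B = {i. i \<le> int n \<and> Y i \<le> n}"
  define D where "D = {i. int n < i \<and> Y i \<le> n}"
  have fin: "finite {i. Y i \<le> n}" by (rule finite_balls[OF after])
  have BD: "{i. Y i \<le> n} = B \<union> D" "B \<inter> D = {}" by (auto simp: B_def D_def)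
  have finBD: "finite B" "finite D" using fin unfolding BD(1) by simp_all
  have n: "n = card B + card D"
    using card_balls[OF after] card_Un_disjoint[OF finBD BD(2)] unfolding BD(1) by simp
  have "inj_on Y D" by (rule inj_on_subset[OF inj_on_balls[OF after]]) (auto simp: D_def)
  then have D: "card D = card (C (int n))"
    using card_image[of Y D] packed_balls_beyond by (simp add: D_def)
  obtain j where "s \<le> card (C j)" using increasing_excess_carrier[OF excess] by blast
  then have "s \<le> card D" using packed_carrier_max[of j] D by simp
  define E where "E = run_starts n Y \<inter> {..int n}"
  have split: "run_starts n Y = insert (int n + 1) E"
  proof -
    have "run_starts n Y = (run_starts n Y \<inter> {int n<..}) \<union> E" by (auto simp: E_def)
    then show ?thesis unfolding packed_starts_beyond by simp
  qed
  have EB: "E \<subseteq> B" by (auto simp: E_def B_def run_starts_def)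
  have "card (run_starts n Y) = Suc (card E)"
    unfolding split using finite_subset[OF EB finBD(1)]
    by (rule card_insert_disjoint) (simp add: E_def)
  then have "card B \<le> card E" using many n \<open>s \<le> card D\<close> by simp
  then have "E = B" using EB finBD by (intro card_seteq) auto
  have "int n + 1 \<in> run_starts n Y" unfolding split by simp
  then have ball: "Y (int n + 1) \<le> n" by (simp add: run_starts_def)
  moreover have "run_starts n Y = {i. i \<le> int n + 1 \<and> Y i \<le> n}"
  proof -
    have "i \<in> insert (int n + 1) B \<longleftrightarrow> i \<le> int n + 1 \<and> Y i \<le> n" for i
      using ball by (cases "i = int n + 1") (auto simp: B_def)
    then show ?thesis unfolding split \<open>E = B\<close> by (intro set_eqI) simp
  qed
  ultimately show ?thesis using after unfolding singles_then_run_def by blast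
qed

end

end

theorem theorem3:
  fixes n :: nat and w :: "nat \<Rightarrow> nat" and SD :: "nat list list"
  assumes "w permutes {1..n}"
    and "is_soliton_decomposition n w SD"
    and "L_shape (tableau_shape SD)"
  shows "steady_state_time n w = 0 \<or> steady_state_time n w = 1"
proof -
  define W where "W = perm_config n w"
  have W: "configuration n W"
    unfolding W_def by (rule configuration_perm_config[OF assms(1)])
  obtain t where steady: "steady_state n ((bbs_move n ^^ t) W)"
    and rows: "soliton_rows n ((bbs_move n ^^ t) W) SD"
    using assms(2) unfolding is_soliton_decomposition_def W_def by blast
  obtain s k where shape: "tableau_shape SD = s # replicate k 1"
    using assms(3) by (auto simp: L_shape_def)
  have time: "steady_state_time n w \<le> t'" if "steady_state n ((bbs_move n ^^ t') W)" for t'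
    unfolding steady_state_time_def using that by (intro Least_le) (simp add: W_def)
  show ?thesis
  proof (cases t)
    case 0
    then show ?thesis using time[OF steady] by simp
  next
    case (Suc u)
    define Z where "Z = (bbs_move n ^^ t) W"
    have Z: "configuration n Z" unfolding Z_def by (rule configuration_bbs_moves[OF W])
    obtain r T where SD: "SD = r # T" and r: "length r = s"
      using shape by (auto simp: tableau_shape_def)
    have "soliton n Z r" using rows SD by (auto simp: soliton_rows_def Z_def)
    then have run: "increasing_run n Z r" unfolding soliton_def by (metis funpow_0)
    then obtain a b where "a \<le> b" "\<forall>i\<in>{a..b}. Z i \<in> {1..n}"
      by (rule increasing_run_start[OF Z])
    then have n: "1 \<le> n" by force
    interpret bbs_step n W "bbs_move n W" by (rule bbs_step_bbs_move[OF W])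
    have Z_eq: "Z = (bbs_move n ^^ u) (bbs_move n W)"
      unfolding Z_def Suc by (simp add: funpow_swap1)
    have "increasing_excess n Z s" using increasing_excess_run[OF run] r by simp
    then have excess: "increasing_excess n (bbs_move n W) s"
      unfolding Z_eq by (rule increasing_excess_bbs_moves[OF after])
    have "length SD = Suc k" using arg_cong[OF shape, of length] by (simp add: tableau_shape_def)
    then have "Suc k \<le> card (run_starts n Z)"
      using length_soliton_rows[OF Z, of SD] rows by (simp add: Z_def)
    also have "\<dots> = card (run_starts n (bbs_move n W))"
      unfolding Z_eq by (rule card_run_starts_bbs_moves[OF after])
    finally have "Suc k \<le> card (run_starts n (bbs_move n W))" .
    moreover have "n \<le> s + k"
      using balls_le_sum_tableau_shape[OF steady rows] shape by (simp add: sum_list_replicate)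
    ultimately have many: "n < s + card (run_starts n (bbs_move n W))" by simp
    have packed: "W i \<le> n \<longleftrightarrow> 1 \<le> i \<and> i \<le> int n" for i
    proof (cases "1 \<le> i \<and> i \<le> int n")
      case True
      then have "nat i \<in> {1..n}" by (simp add: nat_le_iff le_nat_iff)
      then have "w (nat i) \<in> {1..n}" using permutes_in_image[OF assms(1)] by blast
      then show ?thesis using True by (simp add: W_def perm_config_def)
    qed (auto simp: W_def perm_config_def empty_box_def)
    obtain A where "singles_then_run n A (bbs_move n W)"
      using packed_singles_then_run[OF packed n excess many] by blast
    then have "steady_state n (bbs_move n W)" by (rule singles_then_run_steady_state)
    then have "steady_state_time n w \<le> 1" using time[of 1] by simp
    then show ?thesis by linarith
  qed
qed

end
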